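(* Let $n>1$ be an integer and let $a,b\in\mathbb Z_n$ be incomparable with respect to $\leq$. Let $d=\gcd(\gcd(a-1,b-1),n)$. Then the meet $a\wedge b$ (greatest lower bound of $\{a,b\}$) exists in $(\mathbb Z_n,\leq)$ if and only if the ideal $(n/d)$ of $\mathbb Z_n$ has a largest element with respect to $\leq$.
   Context: On $\mathbb Z_n$ define the partial order $\leq$ by: $a\leq b$ iff $a=b$ or $a\equiv ab\pmod n$. For $x\in\mathbb Z_n$, $(x)$ denotes the ideal of $\mathbb Z_n$ generated by $x$. Gcds are taken of integer representatives. *)

theory Defs
  imports "HOL-Number_Theory.Residues" "HOL-Algebra.Ideal" "HOL-Algebra.Order"
begin

definition zn_order :: "int \<Rightarrow> int gorder" where
  "zn_order n =
     \<lparr>carrier = carrier (residue_ring n),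
      eq = (=),
      le = (\<lambda>a b. a = b \<or> [a = a * b] (mod n))\<rparr>"

lemma partial_order_zn_order:
  "partial_order (zn_order n)"
proof
  fix x y
  assume xy: "x \<sqsubseteq>\<^bsub>zn_order n\<^esub> y" "y \<sqsubseteq>\<^bsub>zn_order n\<^esub> x"
    and c: "x \<in> carrier (zn_order n)" "y \<in> carrier (zn_order n)"
  have "[x = y] (mod n)"
    using xy by (auto simp: zn_order_def) (metis cong_sym cong_trans mult.commute)
  then show "x .=\<^bsub>zn_order n\<^esub> y"
    using c by (auto simp: zn_order_def residue_ring_def cong_def)
next
  fix x y z
  assume xy: "x \<sqsubseteq>\<^bsub>zn_order n\<^esub> y" and yz: "y \<sqsubseteq>\<^bsub>zn_order n\<^esub> z"
  show "x \<sqsubseteq>\<^bsub>zn_order n\<^esub> z"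
  proof (cases "x = y \<or> y = z")
    case True
    then show ?thesis using xy yz by auto
  next
    case False
    then have 1: "[x = x * y] (mod n)" and 2: "[y = y * z] (mod n)"
      using xy yz by (auto simp: zn_order_def)
    have "[x * y = x * (y * z)] (mod n)"
      using 2 by (rule cong_scalar_left)
    moreover have "[x * z = x * y * z] (mod n)"
      using 1 by (rule cong_scalar_right)
    ultimately have "[x = x * z] (mod n)"
      using 1 by (metis cong_sym cong_trans mult.assoc)
    then show ?thesis by (simp add: zn_order_def)
  qed
qed (auto simp: zn_order_def)

end

theory Submission
  imports Defs
begin

text \<open>
  Apart from \<open>c = x\<close>, the relation \<open>c \<le> x\<close> says that \<open>c\<close> annihilates \<open>x - 1\<close>. If no element of \<open>A\<close>
  is a lower bound of \<open>A\<close>, the exceptional case \<open>c = x\<close> contributes nothing, so the lower bounds of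
  \<open>A\<close> are the common annihilators of the elements \<open>x - 1\<close> for \<open>x \<in> A\<close>. These form the ideal
  generated by \<open>n div d\<close>, where \<open>d\<close> is the gcd of \<open>n\<close> and all \<open>x - 1\<close>. A pair of incomparable
  elements is such a set \<open>A\<close>.
\<close>

lemma (in semiring_Gcd) dvd_mult_Gcd_iff:
  "a dvd c * Gcd A \<longleftrightarrow> (\<forall>x\<in>A. a dvd c * x)"
proof -
  have "a dvd c * Gcd A \<longleftrightarrow> a dvd Gcd ((*) c ` A)"
    by (simp add: Gcd_mult)
  also have "\<dots> \<longleftrightarrow> (\<forall>x\<in>A. a dvd c * x)"
    by (simp add: dvd_Gcd_iff)
  finally show ?thesis .
qed

lemma (in semiring_gcd) dvd_mult_iff_div_gcd_dvd:
  assumes "b \<noteq> 0"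
  shows "b dvd c * a \<longleftrightarrow> b div gcd a b dvd c"
proof -
  have "b dvd c * a \<longleftrightarrow> b dvd gcd (c * a) (c * b)"
    by simp
  also have "\<dots> \<longleftrightarrow> b dvd c * gcd a b"
    by (simp add: gcd_mult_left)
  also have "\<dots> \<longleftrightarrow> b div gcd a b dvd c"
    using assms by (simp add: div_dvd_iff_mult)
  finally show ?thesis .
qed

lemma (in residues) genideal_singleton_mod:
  "Idl {x mod m} = {y \<in> carrier R. gcd x m dvd y}"
proof -
  have "Idl {x mod m} = PIdl (x mod m)"
    by (simp add: cring.cgenideal_eq_genideal[OF cring])
  also have "\<dots> = {y \<in> carrier R. gcd x m dvd y}"
  proof (intro equalityI subsetI)
    fix y
    assume "y \<in> PIdl (x mod m)"
    then obtain z where "y = z * x mod m"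
      by (auto simp: cgenideal_def res_mult_eq mod_mult_right_eq)
    then show "y \<in> {y \<in> carrier R. gcd x m dvd y}"
      by (simp add: dvd_mod)
  next
    fix y
    assume "y \<in> {y \<in> carrier R. gcd x m dvd y}"
    then obtain z where "[x * z = y] (mod m)" and "y mod m = y"
      using cong_solve_dvd_int[of x m y] by (auto simp: res_carrier_eq)
    then have "y = (z mod m) \<otimes> (x mod m)"
      by (simp add: res_mult_eq cong_def mod_mult_eq mult.commute)
    then show "y \<in> PIdl (x mod m)"
      unfolding cgenideal_def using mod_in_carrier by blast
  qed
  finally show ?thesis .
qed

lemma carrier_zn_order [simp]: "carrier (zn_order n) = carrier (residue_ring n)"
  by (simp add: zn_order_def)

lemma zn_order_le_iff_dvd: "c \<sqsubseteq>\<^bsub>zn_order n\<^esub> x \<longleftrightarrow> c = x \<or> n dvd c * (x - 1)"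
  by (simp add: zn_order_def cong_iff_dvd_diff dvd_diff_commute[of n c] right_diff_distrib)

lemma Lower_zn_order_eq_multiples:
  assumes "n \<noteq> 0"
    and "A \<subseteq> carrier (residue_ring n)"
    and "A \<inter> Lower (zn_order n) A = {}"
  shows "Lower (zn_order n) A =
    {c \<in> carrier (residue_ring n). n div gcd (Gcd ((\<lambda>x. x - 1) ` A)) n dvd c}"
proof -
  have Lower_iff: "c \<in> Lower (zn_order n) A \<longleftrightarrow>
      c \<in> carrier (residue_ring n) \<and> (\<forall>x\<in>A. c = x \<or> n dvd c * (x - 1))" for c
    using assms(2) by (auto simp: Lower_def zn_order_le_iff_dvd)
  have Lower_not_mem: "c \<notin> A" if "c \<in> Lower (zn_order n) A" for c
    using assms(3) that by (metis IntI empty_iff)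
  have "c \<in> Lower (zn_order n) A \<longleftrightarrow>
      c \<in> carrier (residue_ring n) \<and> (\<forall>x\<in>A. n dvd c * (x - 1))" for c
    using Lower_iff Lower_not_mem by metis
  with assms(1) show ?thesis
    by (simp add: set_eq_iff dvd_mult_Gcd_iff flip: dvd_mult_iff_div_gcd_dvd)
qed

theorem theorem3p3:
  fixes n a b d :: int
  assumes "n > 1"
    and "a \<in> carrier (residue_ring n)"
    and "b \<in> carrier (residue_ring n)"
    and "\<not> a \<sqsubseteq>\<^bsub>zn_order n\<^esub> b"
    and "\<not> b \<sqsubseteq>\<^bsub>zn_order n\<^esub> a"
    and "d = gcd (gcd (a - 1) (b - 1)) n"
  shows "(\<exists>m. is_glb (zn_order n) m {a, b}) \<longleftrightarrow>
         (\<exists>g. greatest (zn_order n) g (Idl\<^bsub>residue_ring n\<^esub> {(n div d) mod n}))"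
proof -
  interpret residues n "residue_ring n"
    using assms(1) by unfold_locales simp_all
  have disjoint: "{a, b} \<inter> Lower (zn_order n) {a, b} = {}"
    using assms(2-5) by (auto simp: Lower_def)
  have "Lower (zn_order n) {a, b} = {c \<in> carrier (residue_ring n). n div d dvd c}"
    using Lower_zn_order_eq_multiples[OF _ _ disjoint] assms(1-3,6) by simp
  also have "\<dots> = {c \<in> carrier (residue_ring n). gcd (n div d) n dvd c}"
    using assms(1,6) by (simp add: gcd_proj1_if_dvd div_dvd_iff_mult)
  also have "\<dots> = Idl\<^bsub>residue_ring n\<^esub> {(n div d) mod n}"
    by (simp add: genideal_singleton_mod)
  finally show ?thesis
    by simp
qed

end
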